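(* Let $s\ge 1$ and $r\ge 0$ be integers. Let $H$ be an $s$-critical graph with vertices $v_1,\dots,v_q$ (so $q=|V(H)|$), and let $L_1,\dots,L_q$ be $(r+1)$-critical graphs (taken vertex-disjoint from each other and from $H$). Choose a vertex $w_i\in V(L_i)$ for each $i\in\{1,\dots,q\}$, and let $G$ be the graph formed from the disjoint union of $H,L_1,\dots,L_q$ by identifying $v_i$ with $w_i$ for every $i\in\{1,\dots,q\}$. Then $\mathrm{td}(G)=r+s$.
   Context: Graphs are finite and simple. A $k$-ranking of a graph $G$ is a labeling of $V(G)$ with values from $\{1,\dots,k\}$ such that every path joining two distinct vertices with the same label contains a vertex having a larger label. The tree-depth $\mathrm{td}(G)$ is the smallest $k$ for which $G$ has a $k$-ranking (the graph with no vertices has tree-depth $0$). A graph is $k$-critical if it has tree-depth $k$ and every proper minor of it has tree-depth less than $k$. *)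

theory Defs
  imports "Graph_Theory.Graph_Theory"
begin

text \<open>
  A finite simple graph is a \<open>pair_graph\<close> of the AFP entry \<open>Graph_Theory\<close>: finitely many
  vertices, and a symmetric irreflexive set of arcs, so that the undirected edge \<open>uv\<close> is the
  pair of arcs \<open>(u,v)\<close>, \<open>(v,u)\<close>. The graph without vertices is allowed.
\<close>

definition ranking :: "nat \<Rightarrow> 'a pair_pre_digraph \<Rightarrow> ('a \<Rightarrow> nat) \<Rightarrow> bool" where
  "ranking k G f \<longleftrightarrow>
     f ` pverts G \<subseteq> {1..k} \<and>
     (\<forall>p. vpath p (with_proj G) \<and> hd p \<noteq> last p \<and> f (hd p) = f (last p)
          \<longrightarrow> (\<exists>x\<in>set p. f (hd p) < f x))"

definition tree_depth :: "'a pair_pre_digraph \<Rightarrow> nat" where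
  "tree_depth G = (LEAST k. \<exists>f. ranking k G f)"

definition delete_vertex :: "'a pair_pre_digraph \<Rightarrow> 'a \<Rightarrow> 'a pair_pre_digraph" where
  "delete_vertex G u =
     \<lparr> pverts = pverts G - {u}, parcs = {(x, y) \<in> parcs G. x \<noteq> u \<and> y \<noteq> u} \<rparr>"

definition delete_edge :: "'a pair_pre_digraph \<Rightarrow> 'a \<Rightarrow> 'a \<Rightarrow> 'a pair_pre_digraph" where
  "delete_edge G u v = \<lparr> pverts = pverts G, parcs = parcs G - {(u, v), (v, u)} \<rparr>"

text \<open>
  The simple graph obtained from \<open>G\<close> by identifying vertices that have the same image under \<open>f\<close>,
  where the vertex resulting from \<open>x\<close> is named \<open>f x\<close>. Loops are dropped; parallel edges cannot
  arise because the edges form a set.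
\<close>

definition identify_vertices :: "('a \<Rightarrow> 'b) \<Rightarrow> 'a pair_pre_digraph \<Rightarrow> 'b pair_pre_digraph" where
  "identify_vertices f G =
     \<lparr> pverts = f ` pverts G,
       parcs = {(f x, f y) | x y. (x, y) \<in> parcs G \<and> f x \<noteq> f y} \<rparr>"

definition contract_edge :: "'a pair_pre_digraph \<Rightarrow> 'a \<Rightarrow> 'a \<Rightarrow> 'a pair_pre_digraph" where
  "contract_edge G u v = identify_vertices (\<lambda>x. if x = v then u else x) G"

inductive minor_step :: "'a pair_pre_digraph \<Rightarrow> 'a pair_pre_digraph \<Rightarrow> bool" for G where
  del_vertex: "u \<in> pverts G \<Longrightarrow> minor_step G (delete_vertex G u)"
| del_edge: "(u, v) \<in> parcs G \<Longrightarrow> minor_step G (delete_edge G u v)"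
| contract: "(u, v) \<in> parcs G \<Longrightarrow> minor_step G (contract_edge G u v)"

text \<open>
  Every step lowers the number of vertices or edges, so a minor is proper exactly when at least
  one step was performed. Each proper minor is represented on a subset of the original vertices;
  isomorphic copies are not listed separately.
\<close>

definition proper_minor :: "'a pair_pre_digraph \<Rightarrow> 'a pair_pre_digraph \<Rightarrow> bool" where
  "proper_minor M G \<longleftrightarrow> minor_step\<^sup>+\<^sup>+ G M"

definition critical :: "nat \<Rightarrow> 'a pair_pre_digraph \<Rightarrow> bool" where
  "critical k G \<longleftrightarrow>
     pair_graph G \<and> tree_depth G = k \<and> (\<forall>M. proper_minor M G \<longrightarrow> tree_depth M < k)"

text \<open>
  A disjoint union if the vertex sets are pairwise disjoint.
\<close>

definition graph_Union :: "'a pair_pre_digraph set \<Rightarrow> 'a pair_pre_digraph" where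
  "graph_Union \<G> = \<lparr> pverts = (\<Union>G\<in>\<G>. pverts G), parcs = (\<Union>G\<in>\<G>. parcs G) \<rparr>"

text \<open>
  The union of \<open>H\<close> and the graphs \<open>L i\<close> (\<open>i \<in> I\<close>), with \<open>v i\<close> identified with \<open>w i\<close> for all
  \<open>i \<in> I\<close>; the merged vertex is named \<open>w i\<close>. Intended for \<open>v\<close> injective on \<open>I\<close>.
\<close>

definition attach ::
  "'i set \<Rightarrow> 'a pair_pre_digraph \<Rightarrow> ('i \<Rightarrow> 'a) \<Rightarrow> ('i \<Rightarrow> 'a pair_pre_digraph) \<Rightarrow> ('i \<Rightarrow> 'a)
     \<Rightarrow> 'a pair_pre_digraph" where
  "attach I H v L w =
     identify_vertices (\<lambda>x. if x \<in> v ` I then w (inv_into I v x) else x)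
       (graph_Union (insert H (L ` I)))"

end

theory Submission
  imports Defs
begin

text \<open>
  The graph \<open>G\<close> consists of a copy of \<open>H\<close> on the vertices \<open>w i\<close>, each of which carries a pendant
  graph \<open>L i\<close>. Both inequalities come from translating rankings between \<open>G\<close> and its
  parts. Criticality of \<open>L i\<close> provides that \<open>L i - w i\<close> has an \<open>r\<close>-ranking whereas \<open>L i\<close> has none.

  Upper bound (lemma \<open>ranking_attach\<close>): label each \<open>L i - w i\<close> by an \<open>r\<close>-ranking and put the labels
  of an \<open>s\<close>-ranking of \<open>H\<close>, shifted up by \<open>r\<close>, on the vertices \<open>w i\<close>. A path between
  two equal small labels stays in one \<open>L i - w i\<close> or passes through some \<open>w j\<close>, which has a larger
  label; a path between two equal large labels projects to a walk in \<open>H\<close>.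

  Lower bound (lemma \<open>ranking_core\<close>): in a \<open>k\<close>-ranking \<open>F\<close> of \<open>G\<close>, the component of \<open>w i\<close> in \<open>L i\<close>
  has a label larger than \<open>r\<close>; otherwise this component could keep its labels while the rest of
  \<open>L i\<close> took an \<open>r\<close>-ranking of \<open>L i - w i\<close>, giving an \<open>r\<close>-ranking of \<open>L i\<close> (lemma
  \<open>component_label_exceeds\<close>). Labelling \<open>v i\<close> by the largest label of this component, minus \<open>r\<close>,
  gives a ranking of \<open>H\<close> with \<open>k - r\<close> labels: a path of \<open>H\<close> violating it would lift to a connection
  in \<open>G\<close> between the two maxima on which no label exceeds theirs. Hence \<open>s \<le> k - r\<close>.
\<close>

section \<open>Rankings as a reachability condition\<close>

definition arcs_upto :: "'a pair_pre_digraph \<Rightarrow> ('a \<Rightarrow> nat) \<Rightarrow> nat \<Rightarrow> ('a \<times> 'a) set" where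
  "arcs_upto G f c = {(x, y) \<in> parcs G. f x \<le> c \<and> f y \<le> c}"

lemma vwalk_imp_arcs_upto:
  assumes "vwalk p (with_proj G)" "\<forall>x\<in>set p. f x \<le> c"
  shows "(hd p, last p) \<in> (arcs_upto G f c)\<^sup>*"
  using assms
proof (induction p rule: list.induct)
  case (Cons x xs)
  show ?case
  proof (cases "xs = []")
    case False
    then have "(x, hd xs) \<in> arcs_upto G f c" "vwalk xs (with_proj G)"
      using Cons.prems by (cases xs; simp add: arcs_upto_def vwalk_def)+
    with Cons False show ?thesis by (simp add: converse_rtrancl_into_rtrancl)
  qed simp
qed (simp add: vwalk_def)

lemma arcs_upto_imp_vwalk:
  assumes "pair_wf_digraph G" "(u, v) \<in> (arcs_upto G f c)\<^sup>*" "v \<in> pverts G" "f v \<le> c"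
  shows "\<exists>p. vwalk p (with_proj G) \<and> hd p = u \<and> last p = v \<and> (\<forall>x\<in>set p. f x \<le> c)"
  using assms(2)
proof (induction rule: converse_rtrancl_induct)
  case base
  show ?case using assms by (intro exI[of _ "[v]"]) auto
next
  case (step x y)
  then obtain p where p: "vwalk p (with_proj G)" "hd p = y" "last p = v" "\<forall>x\<in>set p. f x \<le> c"
    by blast
  have "vwalk (x # p) (with_proj G)"
    using p step(1) pair_wf_digraph.in_arcsD1[OF assms(1)]
    by (intro vwalk_consI) (auto simp: arcs_upto_def)
  moreover have "p \<noteq> []" using p(1) by (auto simp: vwalk_def)
  ultimately show ?case
    using p step(1) by (intro exI[of _ "x # p"]) (auto simp: arcs_upto_def)
qed

text \<open>
  A walk without labels above \<open>f u\<close> contains a path without such labels, so paths may be replaced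
  by the reflexive transitive closure, which every arc-preserving map between graphs respects.
\<close>

lemma ranking_iff:
  assumes "pair_wf_digraph G"
  shows "ranking k G f \<longleftrightarrow> f ` pverts G \<subseteq> {1..k} \<and>
    (\<forall>u\<in>pverts G. \<forall>v\<in>pverts G. u \<noteq> v \<and> f u = f v \<longrightarrow> (u, v) \<notin> (arcs_upto G f (f u))\<^sup>*)"
    (is "_ \<longleftrightarrow> ?range \<and> ?sep")
proof
  assume R: "ranking k G f"
  have ?sep
  proof (intro ballI impI notI)
    fix u v assume uv: "u \<in> pverts G" "v \<in> pverts G" "u \<noteq> v \<and> f u = f v"
      "(u, v) \<in> (arcs_upto G f (f u))\<^sup>*"
    then obtain p where p: "vwalk p (with_proj G)" "hd p = u" "last p = v" "\<forall>x\<in>set p. f x \<le> f u"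
      using arcs_upto_imp_vwalk[OF assms uv(4) uv(2)] by auto
    let ?p = "vwalk_to_vpath p"
    have "vpath ?p (with_proj G)" "hd ?p = u" "last ?p = v"
      using p by (simp_all add: vwalk_to_vpath_vpath vwalk_to_vpath_hd vwalk_to_vpath_last)
    with R uv obtain x where "x \<in> set ?p" "f u < f x"
      unfolding ranking_def by metis
    with p(4) show False by (meson leD vwalk_to_vpath_subset)
  qed
  with R show "?range \<and> ?sep" by (simp add: ranking_def)
next
  assume A: "?range \<and> ?sep"
  have "\<exists>x\<in>set p. f (hd p) < f x"
    if p: "vpath p (with_proj G)" "hd p \<noteq> last p" "f (hd p) = f (last p)" for p
  proof (rule ccontr)
    assume "\<not> ?thesis"
    then have "(hd p, last p) \<in> (arcs_upto G f (f (hd p)))\<^sup>*"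
      using p(1) by (intro vwalk_imp_arcs_upto) (auto simp: vpath_def)
    moreover have "hd p \<in> pverts G" "last p \<in> pverts G"
      using p(1) by (auto simp: vpath_def vwalk_def)
    ultimately show False using A p by blast
  qed
  with A show "ranking k G f" by (simp add: ranking_def)
qed

lemma ranking_subgraph:
  assumes "ranking k G f" "pverts K \<subseteq> pverts G" "parcs K \<subseteq> parcs G"
  shows "ranking k K f"
proof -
  have "vpath p (with_proj G)" if "vpath p (with_proj K)" for p
    using that assms(2,3) by (auto simp: vpath_def vwalk_def)
  then show ?thesis using assms(1,2) unfolding ranking_def by blast
qed

lemma ranking_mono: "ranking k G f \<Longrightarrow> k \<le> l \<Longrightarrow> ranking l G f"
  unfolding ranking_def by fastforce

lemma ex_ranking_tree_depth:
  assumes "finite (pverts G)"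
  shows "\<exists>f. ranking (tree_depth G) G f"
proof -
  from assms obtain f :: "'a \<Rightarrow> nat" where f: "f ` pverts G = {1..card (pverts G)}" "inj_on f (pverts G)"
    using finite_same_card_bij[of "pverts G" "{1..card (pverts G)}"] by (auto simp: bij_betw_def)
  have "ranking (card (pverts G)) G f"
    unfolding ranking_def
  proof (intro conjI allI impI)
    fix p assume p: "vpath p (with_proj G) \<and> hd p \<noteq> last p \<and> f (hd p) = f (last p)"
    then have "hd p \<in> pverts G" "last p \<in> pverts G" by (auto simp: vpath_def vwalk_def)
    with p f(2) show "\<exists>x\<in>set p. f (hd p) < f x" by (auto dest: inj_onD)
  qed (use f in auto)
  then show ?thesis
    unfolding tree_depth_def using LeastI_ex[of "\<lambda>k. \<exists>f. ranking k G f"] by blast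
qed

lemma tree_depth_le_iff:
  assumes "finite (pverts G)"
  shows "tree_depth G \<le> k \<longleftrightarrow> (\<exists>f. ranking k G f)"
proof
  show "\<exists>f. ranking k G f" if "tree_depth G \<le> k"
    using ex_ranking_tree_depth[OF assms] ranking_mono that by blast
  show "tree_depth G \<le> k" if "\<exists>f. ranking k G f"
    unfolding tree_depth_def using that by (rule Least_le)
qed

lemma wf_delete_vertex:
  assumes "pair_wf_digraph G"
  shows "pair_wf_digraph (delete_vertex G u)"
  using pair_wf_digraph.wellformed'[OF assms]
  by unfold_locales (auto simp: delete_vertex_def)

lemma critical_delete_vertex:
  assumes "critical k G" "u \<in> pverts G"
  shows "tree_depth (delete_vertex G u) < k"
proof -
  have "proper_minor (delete_vertex G u) G"
    unfolding proper_minor_def using minor_step.del_vertex[OF assms(2)] by (rule tranclp.r_into_trancl)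
  with assms(1) show ?thesis by (simp add: critical_def)
qed

section \<open>Large labels near a vertex whose deletion lowers the tree-depth\<close>

text \<open>
  If the component \<open>C\<close> of \<open>w\<close> used only labels up to \<open>r\<close>, then \<open>f\<close> on \<open>C\<close> together with \<open>h\<close> outside
  \<open>C\<close> would be an \<open>r\<close>-ranking of the whole graph, because no arc joins \<open>C\<close> to its complement.
\<close>

lemma component_label_exceeds:
  assumes G: "pair_graph G" and w: "w \<in> pverts G"
    and f: "ranking k G f"
    and h: "ranking r (delete_vertex G w) h"
    and none: "\<nexists>g. ranking r G g"
  shows "\<exists>x. (w, x) \<in> (parcs G)\<^sup>* \<and> r < f x"
proof (rule ccontr)
  assume small: "\<not> ?thesis"
  interpret pair_graph G by (rule G)
  define C where "C = {x. (w, x) \<in> (parcs G)\<^sup>*}"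
  define g where "g x = (if x \<in> C then f x else h x)" for x
  let ?D = "delete_vertex G w"
  have D: "pair_wf_digraph ?D" by (rule wf_delete_vertex[OF pair_wf_digraph])
  have symG: "sym (parcs G)" using pair_sym_arcs unfolding symmetric_def by simp
  have arcC: "x \<in> C \<longleftrightarrow> y \<in> C" if "(x, y) \<in> parcs G" for x y
    using that symD[OF symG that] by (auto simp: C_def intro: rtrancl_into_rtrancl)
  have wC: "w \<in> C" by (simp add: C_def)
  have "ranking r G g"
    unfolding ranking_iff[OF pair_wf_digraph]
  proof (intro conjI ballI impI notI)
    show "g ` pverts G \<subseteq> {1..r}"
    proof (rule image_subsetI)
      fix x assume x: "x \<in> pverts G"
      show "g x \<in> {1..r}"
      proof (cases "x \<in> C")
        case True
        then have "f x \<le> r" using small by (auto simp: C_def)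
        moreover have "f x \<in> {1..k}" using f x by (auto simp: ranking_def)
        ultimately show ?thesis using True by (simp add: g_def)
      next
        case False
        with wC x have "x \<in> pverts ?D" by (auto simp: delete_vertex_def)
        then have "h x \<in> {1..r}" using h by (auto simp: ranking_def)
        with False show ?thesis by (simp add: g_def)
      qed
    qed
  next
    fix u v assume uv: "u \<in> pverts G" "v \<in> pverts G" "u \<noteq> v \<and> g u = g v"
      and reach: "(u, v) \<in> (arcs_upto G g (g u))\<^sup>*"
    have "v \<in> C \<longleftrightarrow> u \<in> C" and "u \<in> C \<longrightarrow> (u, v) \<in> (arcs_upto G f (g u))\<^sup>*"
      and "u \<notin> C \<longrightarrow> (u, v) \<in> (arcs_upto ?D h (g u))\<^sup>*"
      using reach
    proof (induction rule: rtrancl_induct)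
      case (step y z)
      have yz: "(y, z) \<in> parcs G" "g y \<le> g u" "g z \<le> g u"
        using step(2) by (auto simp: arcs_upto_def)
      { case 1 show ?case using step arcC[OF yz(1)] by blast }
      { case 2
        have "(y, z) \<in> arcs_upto G f (g u)" if "u \<in> C"
          using that yz step(3) arcC[OF yz(1)] by (auto simp: arcs_upto_def g_def)
        then show ?case using step(4) by (auto intro: rtrancl_into_rtrancl) }
      { case 3
        have "(y, z) \<in> arcs_upto ?D h (g u)" if "u \<notin> C"
          using that yz step(3) arcC[OF yz(1)] wC
          by (auto simp: arcs_upto_def g_def delete_vertex_def)
        then show ?case using step(5) by (auto intro: rtrancl_into_rtrancl) }
    qed auto
    then show False
      using uv f h wC unfolding ranking_iff[OF pair_wf_digraph] ranking_iff[OF D]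
      by (cases "u \<in> C") (auto simp: g_def delete_vertex_def)
  qed
  with none show False by blast
qed

section \<open>Attaching pendant graphs to a core\<close>

locale pendant_graphs =
  fixes I :: "'i set" and H :: "'a pair_pre_digraph" and v :: "'i \<Rightarrow> 'a"
    and L :: "'i \<Rightarrow> 'a pair_pre_digraph" and w :: "'i \<Rightarrow> 'a"
  assumes H: "pair_graph H"
    and v: "bij_betw v I (pverts H)"
    and L: "\<And>i. i \<in> I \<Longrightarrow> pair_graph (L i)"
    and LH: "\<And>i. i \<in> I \<Longrightarrow> pverts (L i) \<inter> pverts H = {}"
    and LL: "\<And>i j. i \<in> I \<Longrightarrow> j \<in> I \<Longrightarrow> i \<noteq> j \<Longrightarrow> pverts (L i) \<inter> pverts (L j) = {}"
    and w: "\<And>i. i \<in> I \<Longrightarrow> w i \<in> pverts (L i)"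
begin

abbreviation "G \<equiv> attach I H v L w"

lemma owner_unique: "i \<in> I \<Longrightarrow> j \<in> I \<Longrightarrow> x \<in> pverts (L i) \<Longrightarrow> x \<in> pverts (L j) \<Longrightarrow> i = j"
  using LL by blast

lemma v_eq_iff: "i \<in> I \<Longrightarrow> j \<in> I \<Longrightarrow> v i = v j \<longleftrightarrow> i = j"
  using v by (auto simp: bij_betw_def inj_on_eq_iff)

lemma v_in: "i \<in> I \<Longrightarrow> v i \<in> pverts H"
  using v by (auto simp: bij_betw_def)

lemma core_vertexE:
  assumes "x \<in> pverts H" obtains i where "i \<in> I" "x = v i"
  using assms v by (auto simp: bij_betw_def)

lemma wf_H: "pair_wf_digraph H" and wf_L: "i \<in> I \<Longrightarrow> pair_wf_digraph (L i)"
  using H L by (auto simp: pair_graph_def pair_digraph_def pair_fin_digraph_def)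

lemma L_arcD: "i \<in> I \<Longrightarrow> (x, y) \<in> parcs (L i) \<Longrightarrow> x \<in> pverts (L i) \<and> y \<in> pverts (L i) \<and> x \<noteq> y"
  using L[of i] pair_wf_digraph.wellformed'[OF wf_L]
  by (fastforce simp: pair_graph_def pair_digraph_def pair_loopfree_digraph_def
      pair_loopfree_digraph_axioms_def)

lemma H_arcE:
  assumes "(x, y) \<in> parcs H"
  obtains i j where "i \<in> I" "j \<in> I" "x = v i" "y = v j" "i \<noteq> j"
proof -
  have "x \<noteq> y" using H assms
    by (fastforce simp: pair_graph_def pair_digraph_def pair_loopfree_digraph_def
      pair_loopfree_digraph_axioms_def)
  with assms that show ?thesis
    using pair_wf_digraph.wellformed'[OF wf_H assms] by (metis core_vertexE)
qed

lemma sym_L: "i \<in> I \<Longrightarrow> sym (parcs (L i))"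
  using L[of i] by (auto simp: pair_graph_def pair_pseudo_graph_def pair_sym_digraph_def
    pair_sym_digraph_axioms_def symmetric_def)

definition merge :: "'a \<Rightarrow> 'a" where
  "merge x = (if x \<in> v ` I then w (inv_into I v x) else x)"

lemma merge_v: "i \<in> I \<Longrightarrow> merge (v i) = w i"
  using v by (auto simp: merge_def bij_betw_def)

lemma merge_L: "i \<in> I \<Longrightarrow> x \<in> pverts (L i) \<Longrightarrow> merge x = x"
  using LH v by (auto simp: merge_def bij_betw_def)

lemma G_merge: "G = identify_vertices merge (graph_Union (insert H (L ` I)))"
  unfolding attach_def merge_def ..

lemma pverts_G: "pverts G = (\<Union>i\<in>I. pverts (L i))"
proof -
  have "merge ` pverts H = w ` I"
    using v merge_v by (force simp: bij_betw_def)
  moreover have "merge ` (\<Union>i\<in>I. pverts (L i)) = (\<Union>i\<in>I. pverts (L i))"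
    using merge_L by force
  ultimately show ?thesis
    using w by (auto simp: G_merge identify_vertices_def graph_Union_def image_Un)
qed

lemma arc_G_L: "i \<in> I \<Longrightarrow> (x, y) \<in> parcs (L i) \<Longrightarrow> (x, y) \<in> parcs G"
  using L_arcD[of i x y] merge_L[of i]
  by (force simp: G_merge identify_vertices_def graph_Union_def)

lemma arc_G_H:
  assumes "i \<in> I" "j \<in> I" "(v i, v j) \<in> parcs H"
  shows "(w i, w j) \<in> parcs G"
proof -
  have "i \<noteq> j" using assms H_arcE[OF assms(3)] v_eq_iff by metis
  then have "w i \<noteq> w j" using assms w owner_unique by metis
  then show ?thesis
    using assms merge_v unfolding G_merge identify_vertices_def graph_Union_def
    by simp metis
qed

lemma arc_G_cases:
  assumes "(x, y) \<in> parcs G"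
  obtains (pendant) i where "i \<in> I" "(x, y) \<in> parcs (L i)"
  | (core) i j where "i \<in> I" "j \<in> I" "(v i, v j) \<in> parcs H" "x = w i" "y = w j"
proof -
  obtain a b K where ab: "x = merge a" "y = merge b" "(a, b) \<in> parcs K" "K = H \<or> K \<in> L ` I"
    using assms by (auto simp: G_merge identify_vertices_def graph_Union_def)
  show thesis
  proof (cases "K = H")
    case True
    with ab obtain i j where "i \<in> I" "j \<in> I" "a = v i" "b = v j" using H_arcE by metis
    with True ab show thesis using core merge_v by metis
  next
    case False
    with ab obtain i where "i \<in> I" "(a, b) \<in> parcs (L i)" by auto
    with ab show thesis using pendant merge_L L_arcD by metis
  qed
qed

lemma wf_G: "pair_wf_digraph G"
proof -
  have "x \<in> pverts G \<and> y \<in> pverts G" if "(x, y) \<in> parcs G" for x y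
    using that
  proof (cases rule: arc_G_cases)
    case (pendant i)
    then show ?thesis using L_arcD pverts_G by blast
  next
    case (core i j)
    then show ?thesis using w pverts_G by blast
  qed
  then show ?thesis by (force simp: pair_wf_digraph_def)
qed

definition owner :: "'a \<Rightarrow> 'i" where
  "owner x = (THE i. i \<in> I \<and> x \<in> pverts (L i))"

lemma owner_eq: "i \<in> I \<Longrightarrow> x \<in> pverts (L i) \<Longrightarrow> owner x = i"
  unfolding owner_def using owner_unique by blast

text \<open>
  Paths on which all labels are at most \<open>r\<close> avoid every \<open>w j\<close> and hence stay in one \<open>L i - w i\<close>.
  For the labels above \<open>r\<close>, the map sending each \<open>L i\<close> to \<open>v i\<close> turns a path of \<open>G\<close> into a walk of
  \<open>H\<close> whose labels obey the same bound.
\<close>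

lemma ranking_attach:
  assumes f: "ranking s H f"
    and h: "\<And>i. i \<in> I \<Longrightarrow> ranking r (delete_vertex (L i) (w i)) (h i)"
  shows "\<exists>F. ranking (r + s) G F"
proof -
  define F where "F x = (if x = w (owner x) then r + f (v (owner x)) else h (owner x) x)" for x
  have Fw: "F (w i) = r + f (v i)" if "i \<in> I" for i
    using that owner_eq[OF that w[OF that]] by (simp add: F_def)
  have FL: "F x = h i x" if "i \<in> I" "x \<in> pverts (L i)" "x \<noteq> w i" for i x
    using that owner_eq[of i x] by (simp add: F_def)
  have f1: "1 \<le> f (v i)" "f (v i) \<le> s" if "i \<in> I" for i
    using f v_in[OF that] by (auto simp: ranking_def)
  have h1: "1 \<le> h i x" "h i x \<le> r" if "i \<in> I" "x \<in> pverts (L i)" "x \<noteq> w i" for i x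
    using h[OF that(1)] that by (auto simp: ranking_def delete_vertex_def)
  have pendant_reach: "y \<in> pverts (L i) \<and> y \<noteq> w i \<and> (x, y) \<in> (arcs_upto (delete_vertex (L i) (w i)) (h i) c)\<^sup>*"
    if "(x, y) \<in> (arcs_upto G F c)\<^sup>*" "i \<in> I" "x \<in> pverts (L i)" "x \<noteq> w i" "c \<le> r" for x y i c
    using that(1)
  proof (induction rule: rtrancl_induct)
    case (step y z)
    have yz: "(y, z) \<in> parcs G" "F y \<le> c" "F z \<le> c" using step(2) by (auto simp: arcs_upto_def)
    have nw: "z \<noteq> w j \<and> y \<noteq> w j" if "j \<in> I" for j
      using yz Fw[OF that] f1[OF that] \<open>c \<le> r\<close> by auto
    from yz(1) obtain j where j: "j \<in> I" "(y, z) \<in> parcs (L j)"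
      using nw by (cases rule: arc_G_cases) auto
    with step(3) have "(y, z) \<in> parcs (L i)" using owner_unique L_arcD \<open>i \<in> I\<close> by metis
    moreover from this have "y \<in> pverts (L i)" "z \<in> pverts (L i)" using L_arcD \<open>i \<in> I\<close> by auto
    ultimately have "(y, z) \<in> arcs_upto (delete_vertex (L i) (w i)) (h i) c"
      using nw[OF \<open>i \<in> I\<close>] FL[OF \<open>i \<in> I\<close>] yz by (auto simp: arcs_upto_def delete_vertex_def)
    with step(3) \<open>z \<in> pverts (L i)\<close> nw[OF \<open>i \<in> I\<close>] show ?case by auto
  qed (use that in auto)
  have core_reach: "(v (owner x), v (owner y)) \<in> (arcs_upto H f c)\<^sup>*"
    if "(x, y) \<in> (arcs_upto G F (r + c))\<^sup>*" for x y c
    using that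
  proof (induction rule: rtrancl_induct)
    case (step y z)
    have yz: "(y, z) \<in> parcs G" "F y \<le> r + c" "F z \<le> r + c" using step(2) by (auto simp: arcs_upto_def)
    from yz(1) show ?case
    proof (cases rule: arc_G_cases)
      case (pendant i)
      then have "owner y = i" "owner z = i" using L_arcD owner_eq by blast+
      with step(3) show ?thesis by simp
    next
      case (core i j)
      then have "owner y = i" "owner z = j" using w owner_eq by auto
      moreover have "(v i, v j) \<in> arcs_upto H f c"
        using core yz Fw by (auto simp: arcs_upto_def)
      ultimately show ?thesis using step(3) by simp
    qed
  qed auto
  have "ranking (r + s) G F"
    unfolding ranking_iff[OF wf_G]
  proof (intro conjI ballI impI notI)
    show "F ` pverts G \<subseteq> {1..r + s}"
    proof
      fix y assume "y \<in> F ` pverts G"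
      then obtain i x where "i \<in> I" "x \<in> pverts (L i)" "y = F x" unfolding pverts_G by blast
      then show "y \<in> {1..r + s}"
        using Fw[of i] f1[of i] FL[of i x] h1[of i x] by (cases "x = w i") simp_all
    qed
  next
    fix x y assume xy: "x \<in> pverts G" "y \<in> pverts G" "x \<noteq> y \<and> F x = F y"
      and reach: "(x, y) \<in> (arcs_upto G F (F x))\<^sup>*"
    obtain i j where ij: "i \<in> I" "j \<in> I" "x \<in> pverts (L i)" "y \<in> pverts (L j)"
      using xy pverts_G by blast
    show False
    proof (cases "x = w i")
      case False
      then have "F x \<le> r" using FL h1 ij by simp
      from pendant_reach[OF reach ij(1,3) False this]
      have y: "y \<in> pverts (L i)" "y \<noteq> w i"
        "(x, y) \<in> (arcs_upto (delete_vertex (L i) (w i)) (h i) (F x))\<^sup>*" by auto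
      with xy h[OF ij(1)] FL[OF ij(1)] ij(3) False show False
        unfolding ranking_iff[OF wf_delete_vertex[OF wf_L[OF ij(1)]]]
        by (auto simp: delete_vertex_def)
    next
      case True
      then have Fx: "F x = r + f (v i)" using Fw ij by simp
      have y: "y = w j"
        using FL[OF ij(2,4)] h1[OF ij(2,4)] xy Fx f1[OF ij(1)] by fastforce
      then have "f (v i) = f (v j)" using Fw[OF ij(2)] xy Fx by simp
      moreover have "v i \<noteq> v j" using v_eq_iff ij xy y True by auto
      moreover have "(v i, v j) \<in> (arcs_upto H f (f (v i)))\<^sup>*"
        using core_reach[of x y "f (v i)"] reach ij by (simp add: Fx owner_eq)
      ultimately show False using f v_in ij unfolding ranking_iff[OF wf_H] by blast
    qed
  qed
  then show ?thesis by blast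
qed

text \<open>
  The new label of \<open>v i\<close> is attained, up to the shift by \<open>r\<close>, at a vertex \<open>m i\<close> of \<open>L i\<close> that is
  joined to \<open>w i\<close> without exceeding its label. Thus a walk of \<open>H\<close> from \<open>v i\<close> to \<open>v j\<close> with labels at
  most \<open>c\<close> yields one of \<open>G\<close> from \<open>m i\<close> via \<open>w i\<close> and \<open>w j\<close> to \<open>m j\<close> with labels at most \<open>c + r\<close>.
\<close>

lemma ranking_core:
  assumes F: "ranking k G F"
    and h: "\<And>i. i \<in> I \<Longrightarrow> \<exists>h. ranking r (delete_vertex (L i) (w i)) h"
    and none: "\<And>i. i \<in> I \<Longrightarrow> \<nexists>g. ranking r (L i) g"
  shows "\<exists>g. ranking (k - r) H g"
proof -
  define C where "C i = {x. (w i, x) \<in> (parcs (L i))\<^sup>*}" for i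
  have C_sub: "C i \<subseteq> pverts (L i)" if "i \<in> I" for i
  proof
    fix x assume "x \<in> C i"
    then have "(w i, x) \<in> (parcs (L i))\<^sup>*" by (simp add: C_def)
    then show "x \<in> pverts (L i)"
      by induction (use that w L_arcD in auto)
  qed
  have F_range: "1 \<le> F x \<and> F x \<le> k" if "i \<in> I" "x \<in> pverts (L i)" for i x
    using F that pverts_G by (fastforce simp: ranking_def)
  define M where "M i = Max (F ` C i)" for i
  have fin: "finite (F ` C i)" if "i \<in> I" for i
    using F_range that C_sub by (intro finite_subset[of "F ` C i" "{..k}"]) auto
  have M_ge: "F x \<le> M i" if "i \<in> I" "x \<in> C i" for i x
    using fin that by (auto simp: M_def)
  have "\<exists>m\<in>C i. F m = M i" if "i \<in> I" for i
  proof -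
    have "C i \<noteq> {}" by (auto simp: C_def)
    with Max_in[OF fin[OF that]] show ?thesis by (auto simp: M_def)
  qed
  then obtain m where m: "m i \<in> C i" "F (m i) = M i" if "i \<in> I" for i by metis
  have M_gt: "r < M i" if i: "i \<in> I" for i
  proof -
    have "ranking k (L i) F"
      using F i pverts_G arc_G_L by (intro ranking_subgraph[OF F]) auto
    with component_label_exceeds[OF L w] h none i obtain x where "x \<in> C i" "r < F x"
      unfolding C_def by blast
    then show ?thesis using M_ge[OF i] by fastforce
  qed
  have M_le: "M i \<le> k" if "i \<in> I" for i
    using m[OF that] C_sub[OF that] F_range[OF that] by force
  define g where "g x = M (inv_into I v x) - r" for x
  have gv: "g (v i) = M i - r" if "i \<in> I" for i
    using that v by (simp add: g_def bij_betw_def)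
  \<comment> \<open>Both directions are needed: a lifted walk leaves one component and enters another.\<close>
  have C_reach: "(w i, x) \<in> (arcs_upto G F c)\<^sup>*" "(x, w i) \<in> (arcs_upto G F c)\<^sup>*"
    if "i \<in> I" "x \<in> C i" "M i \<le> c" for i x c
  proof -
    have "(w i, x) \<in> (parcs (L i))\<^sup>*" using that by (simp add: C_def)
    then have "(w i, x) \<in> (arcs_upto G F c)\<^sup>* \<and> (x, w i) \<in> (arcs_upto G F c)\<^sup>*"
    proof (induction rule: rtrancl_induct)
      case (step y z)
      have "y \<in> C i" "z \<in> C i" using step by (auto simp: C_def)
      then have "F y \<le> c" "F z \<le> c" using M_ge \<open>i \<in> I\<close> \<open>M i \<le> c\<close> by (meson le_trans)+
      moreover have "(z, y) \<in> parcs (L i)" using sym_L \<open>i \<in> I\<close> step(2) by (meson symD)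
      ultimately have "(y, z) \<in> arcs_upto G F c" "(z, y) \<in> arcs_upto G F c"
        using step(2) arc_G_L \<open>i \<in> I\<close> by (auto simp: arcs_upto_def)
      with step(3) show ?case by (meson converse_rtrancl_into_rtrancl rtrancl_into_rtrancl)
    qed auto
    then show "(w i, x) \<in> (arcs_upto G F c)\<^sup>*" "(x, w i) \<in> (arcs_upto G F c)\<^sup>*" by auto
  qed
  have lift: "\<exists>j\<in>I. y = v j \<and> (w i, w j) \<in> (arcs_upto G F (c + r))\<^sup>*"
    if "(v i, y) \<in> (arcs_upto H g c)\<^sup>*" "i \<in> I" for i y c
    using that(1)
  proof (induction rule: rtrancl_induct)
    case (step y z)
    then obtain j where j: "j \<in> I" "y = v j" "(w i, w j) \<in> (arcs_upto G F (c + r))\<^sup>*" by blast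
    have yz: "(y, z) \<in> parcs H" "g y \<le> c" "g z \<le> c" using step(2) by (auto simp: arcs_upto_def)
    then obtain l where l: "l \<in> I" "z = v l" using H_arcE by metis
    have "w j \<in> C j" "w l \<in> C l" by (auto simp: C_def)
    then have "F (w j) \<le> c + r" "F (w l) \<le> c + r"
      using M_ge[OF j(1)] M_ge[OF l(1)] yz j l gv by fastforce+
    then have "(w j, w l) \<in> arcs_upto G F (c + r)"
      using arc_G_H[OF j(1) l(1)] yz j l by (auto simp: arcs_upto_def)
    with j(3) have "(w i, w l) \<in> (arcs_upto G F (c + r))\<^sup>*" by (rule rtrancl_into_rtrancl)
    with l show ?case by blast
  qed (use that in auto)
  have "ranking (k - r) H g"
    unfolding ranking_iff[OF wf_H]
  proof (intro conjI ballI impI notI)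
    show "g ` pverts H \<subseteq> {1..k - r}"
    proof
      fix y assume "y \<in> g ` pverts H"
      then obtain i where "i \<in> I" "y = g (v i)" using core_vertexE by blast
      then show "y \<in> {1..k - r}" using gv M_gt[of i] M_le[of i] by auto
    qed
  next
    fix x y assume xy: "x \<in> pverts H" "y \<in> pverts H" "x \<noteq> y \<and> g x = g y"
      and reach: "(x, y) \<in> (arcs_upto H g (g x))\<^sup>*"
    obtain i where i: "i \<in> I" "x = v i" using xy core_vertexE by blast
    with lift reach obtain j where j: "j \<in> I" "y = v j"
      and wij: "(w i, w j) \<in> (arcs_upto G F (g x + r))\<^sup>*" by blast
    have Mi: "M i = g x + r" and Mj: "M j = g x + r"
      using gv i j xy M_gt[of i] M_gt[of j] by auto
    have "(m i, w i) \<in> (arcs_upto G F (g x + r))\<^sup>*"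
      using C_reach(2)[OF i(1) m(1)[OF i(1)]] Mi by simp
    also note wij
    also have "(w j, m j) \<in> (arcs_upto G F (g x + r))\<^sup>*"
      using C_reach(1)[OF j(1) m(1)[OF j(1)]] Mj by simp
    finally have "(m i, m j) \<in> (arcs_upto G F (g x + r))\<^sup>*" .
    moreover have "F (m i) = g x + r" "F (m j) = g x + r" using m(2) i(1) j(1) Mi Mj by auto
    moreover have mL: "m i \<in> pverts (L i)" "m j \<in> pverts (L j)"
      using m(1) C_sub i(1) j(1) by blast+
    moreover have "m i \<noteq> m j" using mL owner_unique[OF i(1) j(1)] i j xy by metis
    moreover have "m i \<in> pverts G" "m j \<in> pverts G" using mL i(1) j(1) pverts_G by auto
    ultimately show False using F unfolding ranking_iff[OF wf_G] by metis
  qed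
  then show ?thesis by blast
qed

end

section \<open>The tree-depth of the attached graph\<close>

theorem theorem4p1:
  fixes r s q :: nat
    and H G :: "'a pair_pre_digraph"
    and L :: "nat \<Rightarrow> 'a pair_pre_digraph"
    and v w :: "nat \<Rightarrow> 'a"
  assumes "1 \<le> s"
    and "critical s H"
    and "bij_betw v {1..q} (pverts H)"
    and "\<And>i. i \<in> {1..q} \<Longrightarrow> critical (r + 1) (L i)"
    and "\<And>i. i \<in> {1..q} \<Longrightarrow> pverts (L i) \<inter> pverts H = {}"
    and "\<And>i j. i \<in> {1..q} \<Longrightarrow> j \<in> {1..q} \<Longrightarrow> i \<noteq> j \<Longrightarrow> pverts (L i) \<inter> pverts (L j) = {}"
    and "\<And>i. i \<in> {1..q} \<Longrightarrow> w i \<in> pverts (L i)"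
    and "G = attach {1..q} H v L w"
  shows "tree_depth G = r + s"
proof -
  interpret A: pendant_graphs "{1..q}" H v L w
    using assms by (intro pendant_graphs.intro) (auto simp: critical_def)
  have finL: "finite (pverts (L i))" if "i \<in> {1..q}" for i
    using A.L[OF that] by (auto simp: pair_graph_def pair_digraph_def pair_fin_digraph_def
      pair_fin_digraph_axioms_def)
  have finH: "finite (pverts H)"
    using assms(3) bij_betw_finite by blast
  have finG: "finite (pverts G)"
    using A.pverts_G finL assms(8) by simp
  have tdH: "tree_depth H = s" using assms(2) by (simp add: critical_def)
  have none: "\<nexists>g. ranking r (L i) g" if "i \<in> {1..q}" for i
    using assms(4)[OF that] tree_depth_le_iff[OF finL[OF that], of r] by (simp add: critical_def)
  have del: "\<exists>h. ranking r (delete_vertex (L i) (w i)) h" if "i \<in> {1..q}" for i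
    using critical_delete_vertex[OF assms(4)[OF that] assms(7)[OF that]] finL[OF that]
      tree_depth_le_iff[of "delete_vertex (L i) (w i)" r]
    by (simp add: delete_vertex_def)
  show ?thesis
  proof (rule antisym)
    obtain f where "ranking s H f" using ex_ranking_tree_depth[OF finH] tdH by auto
    moreover obtain h where "\<And>i. i \<in> {1..q} \<Longrightarrow> ranking r (delete_vertex (L i) (w i)) (h i)"
      using del by metis
    ultimately show "tree_depth G \<le> r + s"
      using A.ranking_attach tree_depth_le_iff[OF finG] assms(8) by metis
  next
    obtain F where "ranking (tree_depth G) G F" using ex_ranking_tree_depth[OF finG] by blast
    then have "\<exists>g. ranking (tree_depth G - r) H g"
      using A.ranking_core del none assms(8) by metis
    then have "s \<le> tree_depth G - r" using tree_depth_le_iff[OF finH] tdH by blast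
    \<comment> \<open>Truncated subtraction: \<open>1 \<le> s\<close> excludes \<open>tree_depth G \<le> r\<close>.\<close>
    with assms(1) show "r + s \<le> tree_depth G" by linarith
  qed
qed

end
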